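(* Let $\mathcal{K}$ be a Kreĭn space and $G$ a group of unitary operators on $\mathcal{K}$ whose representation on $\mathcal{K}$ is fundamental. If $\mathcal{K}$ is regularly irreducible under $G$, then $\mathcal{K}$ is (topologically) irreducible under $G$.
   Context: A Kreĭn space is a space $\mathcal{K}$ with a Hermitian sesquilinear form $[\cdot,\cdot]$ admitting a fundamental symmetry $J$ ($J^2=I$, $\langle x,y\rangle=[Jx,y]$ a Hilbert inner product); its topology is that of any such Hilbert norm. Unitarity, adjoints $A^{[*]}$ and positivity ($[Ax,x]\ge0$) are with respect to $[\cdot,\cdot]$. The representation is fundamental if $G$ contains a fundamental symmetry: there is $g\in G$ with $g=g^{[*]}=g^{-1}$ and $g$ positive. A subspace is regular if it is closed and a Kreĭn space for the restricted form. $\mathcal{K}$ is regularly irreducible if it has no invariant regular subspace other than $0$ and $\mathcal{K}$; (topologically) irreducible if it has no invariant closed subspace other than $0$ and $\mathcal{K}$. *)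

theory Defs
  imports "HOL-Analysis.Analysis"
begin

text \<open>
  Complex vector spaces are given by a scalar multiplication on a type, as in the library locale
  \<^locale>\<open>vector_space\<close>. Notions that are needed both for the whole space and for its subspaces
  take the underlying set \<open>V\<close> as an argument. Sesquilinear forms are linear in the first argument.
\<close>

definition hermitian_form_on ::
  "(complex \<Rightarrow> 'a::ab_group_add \<Rightarrow> 'a) \<Rightarrow> 'a set \<Rightarrow> ('a \<Rightarrow> 'a \<Rightarrow> complex) \<Rightarrow> bool" where
  "hermitian_form_on cscale V f \<longleftrightarrow>
     (\<forall>x\<in>V. \<forall>y\<in>V. \<forall>z\<in>V. f (x + y) z = f x z + f y z) \<and>
     (\<forall>c. \<forall>x\<in>V. \<forall>y\<in>V. f (cscale c x) y = c * f x y) \<and>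
     (\<forall>x\<in>V. \<forall>y\<in>V. f y x = cnj (f x y))"

definition inner_product_on ::
  "(complex \<Rightarrow> 'a::ab_group_add \<Rightarrow> 'a) \<Rightarrow> 'a set \<Rightarrow> ('a \<Rightarrow> 'a \<Rightarrow> complex) \<Rightarrow> bool" where
  "inner_product_on cscale V f \<longleftrightarrow>
     hermitian_form_on cscale V f \<and> (\<forall>x\<in>V. x \<noteq> 0 \<longrightarrow> Re (f x x) > 0)"

text \<open>
  The distance of the norm induced by \<open>f\<close> on \<open>V\<close>. The value off \<open>V\<close> is irrelevant; it is fixed
  because \<^locale>\<open>Metric_space\<close> asks for nonnegativity and symmetry of the distance on the whole type.
\<close>

definition form_dist :: "'a set \<Rightarrow> ('a::ab_group_add \<Rightarrow> 'a \<Rightarrow> complex) \<Rightarrow> 'a \<Rightarrow> 'a \<Rightarrow> real" where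
  "form_dist V f x y = (if x \<in> V \<and> y \<in> V then sqrt (Re (f (x - y) (x - y))) else 0)"

definition hilbert_inner_product_on ::
  "(complex \<Rightarrow> 'a::ab_group_add \<Rightarrow> 'a) \<Rightarrow> 'a set \<Rightarrow> ('a \<Rightarrow> 'a \<Rightarrow> complex) \<Rightarrow> bool" where
  "hilbert_inner_product_on cscale V f \<longleftrightarrow>
     inner_product_on cscale V f \<and> Metric_space.mcomplete V (form_dist V f)"

definition fundamental_symmetry_on ::
  "(complex \<Rightarrow> 'a::ab_group_add \<Rightarrow> 'a) \<Rightarrow> 'a set \<Rightarrow> ('a \<Rightarrow> 'a \<Rightarrow> complex) \<Rightarrow> ('a \<Rightarrow> 'a) \<Rightarrow> bool" where
  "fundamental_symmetry_on cscale V form J \<longleftrightarrow>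
     (\<forall>x\<in>V. J x \<in> V) \<and>
     (\<forall>x\<in>V. \<forall>y\<in>V. J (x + y) = J x + J y) \<and>
     (\<forall>c. \<forall>x\<in>V. J (cscale c x) = cscale c (J x)) \<and>
     (\<forall>x\<in>V. J (J x) = x) \<and>
     hilbert_inner_product_on cscale V (\<lambda>x y. form (J x) y)"

definition krein_space_on ::
  "(complex \<Rightarrow> 'a::ab_group_add \<Rightarrow> 'a) \<Rightarrow> 'a set \<Rightarrow> ('a \<Rightarrow> 'a \<Rightarrow> complex) \<Rightarrow> bool" where
  "krein_space_on cscale V form \<longleftrightarrow>
     vector_space cscale \<and> module.subspace cscale V \<and> hermitian_form_on cscale V form \<and>
     (\<exists>J. fundamental_symmetry_on cscale V form J)"

abbreviation krein_space ::
  "(complex \<Rightarrow> 'a::ab_group_add \<Rightarrow> 'a) \<Rightarrow> ('a \<Rightarrow> 'a \<Rightarrow> complex) \<Rightarrow> bool" where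
  "krein_space cscale form \<equiv> krein_space_on cscale UNIV form"

text \<open>
  The topology does not depend on the chosen fundamental symmetry: the Hilbert norms of any two
  fundamental symmetries are equivalent.
\<close>

definition krein_topology ::
  "(complex \<Rightarrow> 'a::ab_group_add \<Rightarrow> 'a) \<Rightarrow> ('a \<Rightarrow> 'a \<Rightarrow> complex) \<Rightarrow> 'a topology" where
  "krein_topology cscale form =
     (let J = (SOME J. fundamental_symmetry_on cscale UNIV form J)
      in Metric_space.mtopology UNIV (form_dist UNIV (\<lambda>x y. form (J x) y)))"

text \<open>
  \<open>B\<close> is the adjoint \<open>A\<^sup>[\<^sup>*\<^sup>]\<close> of \<open>A\<close>; it is unique since the form of a Krein space is nondegenerate.
\<close>

definition is_form_adjoint :: "('a \<Rightarrow> 'a \<Rightarrow> complex) \<Rightarrow> ('a \<Rightarrow> 'a) \<Rightarrow> ('a \<Rightarrow> 'a) \<Rightarrow> bool" where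
  "is_form_adjoint form A B \<longleftrightarrow> (\<forall>x y. form (A x) y = form x (B y))"

text \<open>Continuity is not required: on a Krein space it is automatic for everywhere defined
  operators that have an adjoint.\<close>

definition unitary_operator ::
  "(complex \<Rightarrow> 'a::ab_group_add \<Rightarrow> 'a) \<Rightarrow> ('a \<Rightarrow> 'a \<Rightarrow> complex) \<Rightarrow> ('a \<Rightarrow> 'a) \<Rightarrow> bool" where
  "unitary_operator cscale form U \<longleftrightarrow>
     Vector_Spaces.linear cscale cscale U \<and> bij U \<and> is_form_adjoint form U (inv U)"

definition unitary_operator_group ::
  "(complex \<Rightarrow> 'a::ab_group_add \<Rightarrow> 'a) \<Rightarrow> ('a \<Rightarrow> 'a \<Rightarrow> complex) \<Rightarrow> ('a \<Rightarrow> 'a) set \<Rightarrow> bool" where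
  "unitary_operator_group cscale form G \<longleftrightarrow>
     (\<forall>g\<in>G. unitary_operator cscale form g) \<and>
     id \<in> G \<and> (\<forall>g\<in>G. \<forall>h\<in>G. g \<circ> h \<in> G) \<and> (\<forall>g\<in>G. inv g \<in> G)"

definition positive_operator :: "('a \<Rightarrow> 'a \<Rightarrow> complex) \<Rightarrow> ('a \<Rightarrow> 'a) \<Rightarrow> bool" where
  "positive_operator form A \<longleftrightarrow> (\<forall>x. form (A x) x \<in> \<real>\<^sub>\<ge>\<^sub>0)"

text \<open>On a Krein space, a unitary \<open>g\<close> as below is the same as a unitary fundamental symmetry: the form
  \<open>[g x, y]\<close> is then a Hilbert inner product.\<close>

definition fundamental_representation ::
  "('a \<Rightarrow> 'a \<Rightarrow> complex) \<Rightarrow> ('a \<Rightarrow> 'a) set \<Rightarrow> bool" where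
  "fundamental_representation form G \<longleftrightarrow>
     (\<exists>g\<in>G. is_form_adjoint form g g \<and> g = inv g \<and> positive_operator form g)"

definition invariant_under :: "('a \<Rightarrow> 'a) set \<Rightarrow> 'a set \<Rightarrow> bool" where
  "invariant_under G S \<longleftrightarrow> (\<forall>g\<in>G. g ` S \<subseteq> S)"

definition closed_subspace ::
  "(complex \<Rightarrow> 'a::ab_group_add \<Rightarrow> 'a) \<Rightarrow> ('a \<Rightarrow> 'a \<Rightarrow> complex) \<Rightarrow> 'a set \<Rightarrow> bool" where
  "closed_subspace cscale form S \<longleftrightarrow>
     module.subspace cscale S \<and> closedin (krein_topology cscale form) S"

definition regular_subspace ::
  "(complex \<Rightarrow> 'a::ab_group_add \<Rightarrow> 'a) \<Rightarrow> ('a \<Rightarrow> 'a \<Rightarrow> complex) \<Rightarrow> 'a set \<Rightarrow> bool" where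
  "regular_subspace cscale form S \<longleftrightarrow>
     closed_subspace cscale form S \<and> krein_space_on cscale S form"

definition regularly_irreducible ::
  "(complex \<Rightarrow> 'a::ab_group_add \<Rightarrow> 'a) \<Rightarrow> ('a \<Rightarrow> 'a \<Rightarrow> complex) \<Rightarrow> ('a \<Rightarrow> 'a) set \<Rightarrow> bool" where
  "regularly_irreducible cscale form G \<longleftrightarrow>
     (\<forall>S. regular_subspace cscale form S \<and> invariant_under G S \<longrightarrow> S = {0} \<or> S = UNIV)"

definition topologically_irreducible ::
  "(complex \<Rightarrow> 'a::ab_group_add \<Rightarrow> 'a) \<Rightarrow> ('a \<Rightarrow> 'a \<Rightarrow> complex) \<Rightarrow> ('a \<Rightarrow> 'a) set \<Rightarrow> bool" where
  "topologically_irreducible cscale form G \<longleftrightarrow>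
     (\<forall>S. closed_subspace cscale form S \<and> invariant_under G S \<longrightarrow> S = {0} \<or> S = UNIV)"

end

theory Submission imports Defs begin

text \<open>
  Let \<open>J\<close> be the fundamental symmetry that gives the topology and \<open>g \<in> G\<close> the one provided by the
  fundamental representation. Every closed invariant subspace \<open>S\<close> is invariant under \<open>g\<close>, so \<open>g\<close>
  restricts to a fundamental symmetry of \<open>S\<close>, and \<open>S\<close> is regular, as soon as \<open>[g x, y]\<close> is a Hilbert
  inner product on \<open>S\<close>. This amounts to the equivalence of the norms of \<open>g\<close> and \<open>J\<close>. The sets
  \<open>{x. [g x, x] \<le> n\<^sup>2}\<close> are closed for the norm of \<open>J\<close> and cover the space, so that by Baire's theorem
  the norm of \<open>g\<close> is at most \<open>C\<close> times the norm of \<open>J\<close>. Conversely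
  \<open>\<parallel>x\<parallel>\<^sub>J\<^sup>2 = [g (g J x), x] \<le> \<parallel>g J x\<parallel>\<^sub>g \<parallel>x\<parallel>\<^sub>g = \<parallel>J x\<parallel>\<^sub>g \<parallel>x\<parallel>\<^sub>g \<le> C \<parallel>x\<parallel>\<^sub>J \<parallel>x\<parallel>\<^sub>g\<close>.
\<close>

section \<open>Semi-inner products and their seminorms\<close>

definition form_norm :: "('a \<Rightarrow> 'a \<Rightarrow> complex) \<Rightarrow> 'a \<Rightarrow> real" where
  "form_norm f x = sqrt (Re (f x x))"

text \<open>Nonnegativity is all that is known at first about the form \<open>[g x, y]\<close>; its
  definiteness follows only from the comparison of norms.\<close>

locale semi_inner_product = vector_space cscale
  for cscale :: "complex \<Rightarrow> 'a::ab_group_add \<Rightarrow> 'a" +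
  fixes f :: "'a \<Rightarrow> 'a \<Rightarrow> complex"
  assumes hermitian: "hermitian_form_on cscale UNIV f"
    and nonneg: "0 \<le> Re (f x x)"
begin

lemma add_left: "f (x + y) z = f x z + f y z"
  and scale_left: "f (cscale c x) y = c * f x y"
  and cnj_form: "cnj (f x y) = f y x"
  using hermitian unfolding hermitian_form_on_def by (blast, blast, metis UNIV_I)

lemma diff_left: "f (x - y) z = f x z - f y z"
  using add_left[of "x - y" y z] by simp

lemma add_right: "f z (x + y) = f z x + f z y"
  and diff_right: "f z (x - y) = f z x - f z y"
  and scale_right: "f x (cscale c y) = cnj c * f x y"
  by (metis add_left cnj_form complex_cnj_add, metis diff_left cnj_form complex_cnj_diff,
      metis scale_left cnj_form complex_cnj_mult)

lemma form_norm_zero: "form_norm f 0 = 0"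
  using scale_left[of 0 0 0] by (simp add: form_norm_def)

lemma form_norm_nonneg: "0 \<le> form_norm f x"
  by (simp add: form_norm_def nonneg)

lemma form_norm_square: "(form_norm f x)\<^sup>2 = Re (f x x)"
  by (simp add: form_norm_def nonneg)

text \<open>The quadratic polynomial \<open>quad\<close> in \<open>t\<close>, obtained by expanding
  \<open>f\<close> at \<open>x - t * f x y * y\<close>, is nonnegative. As \<open>f\<close> may be
  degenerate, \<open>b = 0\<close> is a separate case.\<close>

lemma Cauchy_Schwarz: "cmod (f x y) \<le> form_norm f x * form_norm f y"
proof -
  define a where "a = Re (f x x)"
  define b where "b = Re (f y y)"
  define p where "p = (cmod (f x y))\<^sup>2"
  have nn: "0 \<le> a" "0 \<le> b" "0 \<le> p"
    by (simp_all add: a_def b_def p_def nonneg)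
  have quad: "0 \<le> a - 2 * t * p + t\<^sup>2 * p * b" for t
  proof -
    define l where "l = complex_of_real t * f x y"
    have "f (x - cscale l y) (x - cscale l y)
        = f x x - cnj l * f x y - l * cnj (f x y) + l * cnj l * f y y"
      by (simp add: diff_left diff_right scale_left scale_right cnj_form algebra_simps)
    moreover have p: "f x y * cnj (f x y) = of_real p"
      by (simp add: p_def flip: complex_norm_square)
    moreover have "cnj l * f x y = of_real t * (f x y * cnj (f x y))"
      "l * cnj (f x y) = of_real t * (f x y * cnj (f x y))"
      "l * cnj l = (of_real t)\<^sup>2 * (f x y * cnj (f x y))"
      by (simp_all add: l_def power2_eq_square)
    ultimately have "f (x - cscale l y) (x - cscale l y)
        = f x x - of_real (2 * t * p) + of_real (t\<^sup>2 * p) * f y y"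
      by (simp add: algebra_simps)
    then have "Re (f (x - cscale l y) (x - cscale l y)) = a - 2 * t * p + t\<^sup>2 * p * b"
      by (simp only: plus_complex.sel minus_complex.sel Re_complex_of_real a_def b_def) simp
    then show ?thesis
      using nonneg by metis
  qed
  have "p \<le> a * b"
  proof (cases "b = 0")
    case True
    have "p = 0"
    proof (rule ccontr)
      assume "p \<noteq> 0"
      \<comment> \<open>With \<open>b = 0\<close> the polynomial is affine in \<open>t\<close>, and
        this \<open>t\<close> gives it the value -1.\<close>
      then show False
        using quad[of "(a + 1) / (2 * p)"] True by simp
    qed
    then show ?thesis using True by simp
  next
    case False
    \<comment> \<open>The minimum is at \<open>t = 1 / b\<close>.\<close>
    then have "0 \<le> a - p / b"
      using quad[of "1 / b"] by (simp add: power2_eq_square)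
    then show ?thesis
      using False nn by (simp add: field_simps)
  qed
  then have "(cmod (f x y))\<^sup>2 \<le> (form_norm f x * form_norm f y)\<^sup>2"
    by (simp add: power_mult_distrib form_norm_square p_def a_def b_def)
  then show ?thesis
    by (rule power2_le_imp_le) (simp add: form_norm_nonneg)
qed

lemma form_norm_triangle: "form_norm f (x + y) \<le> form_norm f x + form_norm f y"
proof -
  have "Re (f y x) = Re (f x y)"
    using cnj_form[of x y] by (metis cnj.sel(1))
  then have "(form_norm f (x + y))\<^sup>2 = (form_norm f x)\<^sup>2 + 2 * Re (f x y) + (form_norm f y)\<^sup>2"
    by (simp add: form_norm_square add_left add_right)
  moreover have "Re (f x y) \<le> form_norm f x * form_norm f y"
    using Cauchy_Schwarz complex_Re_le_cmod order_trans by blast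
  ultimately have "(form_norm f (x + y))\<^sup>2 \<le> (form_norm f x + form_norm f y)\<^sup>2"
    by (simp add: power2_sum)
  then show ?thesis
    by (rule power2_le_imp_le) (simp add: form_norm_nonneg)
qed

lemma form_norm_minus: "form_norm f (x - y) = form_norm f (y - x)"
  by (simp add: form_norm_def diff_left diff_right)

lemma form_norm_triangle_diff: "form_norm f (x - z) \<le> form_norm f (x - y) + form_norm f (y - z)"
  using form_norm_triangle[of "x - y" "y - z"] by simp

lemma form_norm_scale: "form_norm f (cscale c x) = cmod c * form_norm f x"
proof -
  have "f (cscale c x) (cscale c x) = of_real ((cmod c)\<^sup>2) * f x x"
    by (simp add: scale_left scale_right complex_norm_square del: of_real_power)
  then show ?thesis
    by (simp add: form_norm_def real_sqrt_mult)
qed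

end

lemma form_dist_form_norm: "x \<in> V \<Longrightarrow> y \<in> V \<Longrightarrow> form_dist V f x y = form_norm f (x - y)"
  by (simp add: form_dist_def form_norm_def)

locale inner_product = semi_inner_product +
  assumes pos: "x \<noteq> 0 \<Longrightarrow> 0 < Re (f x x)"
begin

lemma form_norm_eq_0_iff: "form_norm f x = 0 \<longleftrightarrow> x = 0"
  using pos[of x] by (cases "x = 0") (auto simp: form_norm_zero, auto simp: form_norm_def)

lemma Metric_space_form_dist: "Metric_space V (form_dist V f)"
proof
  show "0 \<le> form_dist V f x y" for x y
    by (simp add: form_dist_def nonneg)
  show "form_dist V f x y = form_dist V f y x" for x y
    using form_norm_minus by (simp add: form_dist_def form_norm_def)
  show "form_dist V f x y = 0 \<longleftrightarrow> x = y" if "x \<in> V" "y \<in> V" for x y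
    using that by (simp add: form_dist_form_norm form_norm_eq_0_iff)
  show "form_dist V f x z \<le> form_dist V f x y + form_dist V f y z"
    if "x \<in> V" "y \<in> V" "z \<in> V" for x y z
    using that by (simp add: form_dist_form_norm form_norm_triangle_diff)
qed

end

lemma inner_productI:
  assumes "vector_space cscale" "inner_product_on cscale UNIV f"
  shows "inner_product cscale f"
proof -
  have pos: "0 < Re (f x x)" if "x \<noteq> 0" for x
    using assms(2) that by (simp add: inner_product_on_def)
  have "f 0 0 = 0"
    using assms(2) unfolding inner_product_on_def hermitian_form_on_def
    by (metis UNIV_I add_cancel_right_right)
  then have "0 \<le> Re (f x x)" for x
    using pos[of x] by (cases "x = 0") auto
  then show ?thesis
    using assms pos
    by (intro inner_product.intro semi_inner_product.intro semi_inner_product_axioms.intro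
        inner_product_axioms.intro) (auto simp: inner_product_on_def)
qed

section \<open>Comparison of norms and transfer of completeness\<close>

text \<open>A uniform boundedness argument: boundedness of each functional \<open>f _ y\<close>
  already makes the sublevel sets of the seminorm of \<open>f\<close> closed for \<open>h\<close>.
  By Baire's theorem one of them contains a ball; translation and scaling then give the
  constant.\<close>

lemma form_norm_dominated:
  assumes "inner_product cscale h" and complete: "Metric_space.mcomplete UNIV (form_dist UNIV h)"
    and "semi_inner_product cscale f"
    and bounded: "\<And>y. \<exists>C. \<forall>x. cmod (f x y) \<le> C * form_norm h x"
  shows "\<exists>C. \<forall>x. form_norm f x \<le> C * form_norm h x"
proof -
  interpret h: inner_product cscale h by fact
  interpret f: semi_inner_product cscale f by fact
  interpret M: Metric_space UNIV "form_dist UNIV h" by (rule h.Metric_space_form_dist)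
  define A where "A n = {x. form_norm f x \<le> real n}" for n
  have closed: "closedin M.mtopology (A n)" for n
    unfolding M.closedin_metric
  proof (intro conjI allI impI)
    fix x
    define c where "c = form_norm f x"
    assume "x \<in> UNIV - A n"
    then have c: "real n < c" by (simp add: A_def c_def)
    then have c0: "0 < c" by (meson le_less_trans of_nat_0_le_iff)
    obtain C0 where C0: "\<And>z. cmod (f z x) \<le> C0 * form_norm h z"
      using bounded by blast
    define C where "C = max C0 1"
    have C: "cmod (f z x) \<le> C * form_norm h z" for z
    proof -
      have "C0 * form_norm h z \<le> C * form_norm h z"
        by (rule mult_right_mono) (simp_all add: C_def h.form_norm_nonneg)
      then show ?thesis using C0[of z] by simp
    qed
    have C1: "0 < C" by (simp add: C_def)
    \<comment> \<open>Chosen so that a point \<open>z\<close> of \<open>A n\<close> within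
      \<open>r\<close> of \<open>x\<close> would give
      \<open>c\<^sup>2 < c * (c - n) + n * c = c\<^sup>2\<close>.\<close>
    define r where "r = c * (c - real n) / C"
    have "z \<notin> A n" if "form_norm h (x - z) < r" for z
    proof
      assume "z \<in> A n"
      then have z: "form_norm f z \<le> real n" by (simp add: A_def)
      have "c\<^sup>2 = Re (f (x - z) x) + Re (f z x)"
        by (simp add: c_def f.form_norm_square f.diff_left)
      also have "Re (f (x - z) x) \<le> C * form_norm h (x - z)"
        using C complex_Re_le_cmod order_trans by blast
      also have "C * form_norm h (x - z) < c * (c - real n)"
        using that C1 by (simp add: r_def field_simps)
      also have "Re (f z x) \<le> form_norm f z * c"
        using f.Cauchy_Schwarz complex_Re_le_cmod order_trans c_def by blast
      also have "form_norm f z * c \<le> real n * c"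
        using z c0 by (simp add: mult_right_mono)
      finally show False
        by (simp add: power2_eq_square algebra_simps)
    qed
    then show "\<exists>r>0. disjnt (A n) (M.mball x r)"
      using c c0 C1 by (intro exI[of _ r]) (auto simp: r_def disjnt_iff form_dist_form_norm)
  qed simp
  have "\<exists>n. M.mtopology interior_of A n \<noteq> {}"
  proof (rule ccontr)
    assume "\<not> ?thesis"
    then have "M.mtopology interior_of \<Union>(range A) = {}"
      using closed complete by (intro M.metric_Baire_category_alt) auto
    moreover have "\<Union>(range A) = UNIV"
      by (auto simp: A_def real_arch_simple)
    ultimately show False
      using interior_of_topspace[of M.mtopology] by simp
  qed
  then obtain n a r where r: "0 < r" and ball: "M.mball a r \<subseteq> A n"
    using M.in_interior_of_mball by (metis equals0I)
  have A: "form_norm f x \<le> real n" if "form_norm h (a - x) < r" for x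
    using that ball by (auto simp: A_def form_dist_form_norm subset_iff)
  \<comment> \<open>The ball is moved to the origin by writing \<open>u\<close> as the difference of
    its points \<open>a\<close> and \<open>a - u\<close>.\<close>
  have near0: "form_norm f u \<le> 2 * real n" if "form_norm h u < r" for u
  proof -
    have "form_norm h (a - (a - u)) < r" "form_norm h (a - a) < r"
      using that r by (simp_all add: h.form_norm_zero)
    then have "form_norm f (a - u) \<le> real n" "form_norm f a \<le> real n"
      using A by blast+
    moreover have "form_norm f (a - (a - u)) \<le> form_norm f (a - 0) + form_norm f (0 - (a - u))"
      by (rule f.form_norm_triangle_diff)
    ultimately show ?thesis
      using f.form_norm_minus[of 0 "a - u"] by simp
  qed
  have "form_norm f x \<le> 4 * real n / r * form_norm h x" for x
  proof (cases "x = 0")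
    case True
    then show ?thesis
      by (simp add: f.form_norm_zero h.form_norm_zero)
  next
    case False
    then have h0: "0 < form_norm h x"
      using h.form_norm_eq_0_iff h.form_norm_nonneg by (metis less_eq_real_def)
    \<comment> \<open>Scales \<open>x\<close> to norm \<open>r / 2\<close>, strictly inside the open
      ball.\<close>
    define t where "t = r / (2 * form_norm h x)"
    have "0 < t" using h0 r by (simp add: t_def)
    then have "form_norm h (cscale (of_real t) x) = t * form_norm h x"
      by (simp add: h.form_norm_scale)
    then have "form_norm h (cscale (of_real t) x) = r / 2"
      using h0 by (simp add: t_def)
    then have "t * form_norm f x \<le> 2 * real n"
      using near0[of "cscale (of_real t) x"] r \<open>0 < t\<close> by (simp add: f.form_norm_scale)
    then show ?thesis
      using h0 r by (simp add: t_def field_simps)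
  qed
  then show ?thesis by blast
qed

text \<open>A Cauchy sequence of \<open>S\<close> for \<open>f\<close> is Cauchy for
  \<open>h\<close>, has a limit for \<open>h\<close>, which lies in the closed set \<open>S\<close>,
  and converges to it for \<open>f\<close> as well.\<close>

lemma mcomplete_form_dist_closedin:
  assumes "inner_product cscale h" and complete: "Metric_space.mcomplete UNIV (form_dist UNIV h)"
    and "inner_product cscale f"
    and fh: "\<And>x. form_norm f x \<le> C * form_norm h x"
    and hf: "\<And>x. form_norm h x \<le> D * form_norm f x"
    and closed: "closedin (Metric_space.mtopology UNIV (form_dist UNIV h)) S"
  shows "Metric_space.mcomplete S (form_dist S f)"
proof -
  interpret h: inner_product cscale h by fact
  interpret f: inner_product cscale f by fact
  interpret H: Metric_space UNIV "form_dist UNIV h" by (rule h.Metric_space_form_dist)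
  interpret F: Metric_space S "form_dist S f" by (rule f.Metric_space_form_dist)
  \<comment> \<open>\<open>C\<close> and \<open>D\<close> may be any reals; a common positive
    constant can be divided by.\<close>
  define E where "E = max 1 (max C D)"
  have E: "0 < E" by (simp add: E_def)
  have fh': "form_norm f x \<le> E * form_norm h x" for x
    using fh[of x]
    by (rule order_trans) (simp add: E_def h.form_norm_nonneg mult_right_mono)
  have hf': "form_norm h x \<le> E * form_norm f x" for x
    using hf[of x]
    by (rule order_trans) (simp add: E_def f.form_norm_nonneg mult_right_mono)
  show ?thesis
    unfolding F.mcomplete_def
  proof (intro allI impI)
    fix s assume s: "F.MCauchy s"
    then have inS: "s n \<in> S" for n
      by (auto simp: F.MCauchy_def)
    have "H.MCauchy s"
      unfolding H.MCauchy_def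
    proof (intro conjI allI impI)
      fix e :: real assume "0 < e"
      then have "0 < e / E" using E by simp
      then obtain N where "\<forall>n n'. N \<le> n \<longrightarrow> N \<le> n' \<longrightarrow> form_dist S f (s n) (s n') < e / E"
        using s unfolding F.MCauchy_def by blast
      then have N: "form_norm f (s n - s n') < e / E" if "N \<le> n" "N \<le> n'" for n n'
        using that inS by (simp add: form_dist_form_norm)
      have "form_norm h (s n - s n') < e" if "N \<le> n" "N \<le> n'" for n n'
        using N[OF that] hf'[of "s n - s n'"] E by (simp add: field_simps)
      then show "\<exists>N. \<forall>n n'. N \<le> n \<longrightarrow> N \<le> n' \<longrightarrow> form_dist UNIV h (s n) (s n') < e"
        by (auto simp: form_dist_form_norm)
    qed simp
    then obtain l where l: "limitin H.mtopology s l sequentially"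
      using complete unfolding H.mcomplete_def by blast
    then have "l \<in> S"
      using closed inS unfolding H.metric_closedin_iff_sequentially_closed by blast
    have "limitin F.mtopology s l sequentially"
      unfolding F.limit_metric_sequentially
    proof (intro conjI allI impI)
      fix e :: real assume "0 < e"
      then have "0 < e / E" using E by simp
      then obtain N where N: "\<And>n. N \<le> n \<Longrightarrow> form_norm h (s n - l) < e / E"
        using l unfolding H.limit_metric_sequentially by (auto simp: form_dist_form_norm)
      have "form_norm f (s n - l) < e" if "N \<le> n" for n
        using N[OF that] fh'[of "s n - l"] E by (simp add: field_simps)
      then show "\<exists>N. \<forall>n\<ge>N. s n \<in> S \<and> form_dist S f (s n) l < e"
        using inS \<open>l \<in> S\<close> by (auto simp: form_dist_form_norm)
    qed fact
    then show "\<exists>x. limitin F.mtopology s x sequentially" by blast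
  qed
qed

theorem theorem2p15:
  fixes cscale :: "complex \<Rightarrow> 'a::ab_group_add \<Rightarrow> 'a"
    and form :: "'a \<Rightarrow> 'a \<Rightarrow> complex"
    and G :: "('a \<Rightarrow> 'a) set"
  assumes "krein_space cscale form"
    and "unitary_operator_group cscale form G"
    and "fundamental_representation form G"
    and "regularly_irreducible cscale form G"
  shows "topologically_irreducible cscale form G"
proof -
  interpret vector_space cscale
    using assms(1) by (simp add: krein_space_on_def)
  have herm: "hermitian_form_on cscale UNIV form"
    using assms(1) by (simp add: krein_space_on_def)
  have form_add: "form (x + y) z = form x z + form y z"
    and form_scale: "form (cscale c x) y = c * form x y"
    and form_cnj: "form y x = cnj (form x y)" for x y z c
    using herm unfolding hermitian_form_on_def by blast+

  \<comment> \<open>The very choice made in \<open>krein_topology\<close>, so that the topology is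
    by definition that of the norm of \<open>h\<close>.\<close>
  define J where "J = (SOME J. fundamental_symmetry_on cscale UNIV form J)"
  have J: "fundamental_symmetry_on cscale UNIV form J"
    using assms(1) unfolding krein_space_on_def J_def by (metis someI_ex)
  define h where "h = (\<lambda>x y. form (J x) y)"
  have JJ: "J (J x) = x" for x
    using J by (simp add: fundamental_symmetry_on_def)
  have h: "h x y = form (J x) y" for x y
    by (simp add: h_def)
  have "hilbert_inner_product_on cscale UNIV h"
    using J by (simp add: fundamental_symmetry_on_def h_def)
  then have h_ip: "inner_product cscale h"
    and h_complete: "Metric_space.mcomplete UNIV (form_dist UNIV h)"
    using inner_productI[OF vector_space_axioms] by (auto simp: hilbert_inner_product_on_def)
  interpret h: inner_product cscale h by fact
  \<comment> \<open>Self-adjointness of \<open>J\<close> comes from the Hermitian symmetry of both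
    \<open>form\<close> and \<open>h\<close>.\<close>
  have J_adj: "form (J x) y = form x (J y)" for x y
    by (metis form_cnj h h.cnj_form)
  have topology: "krein_topology cscale form = Metric_space.mtopology UNIV (form_dist UNIV h)"
    by (simp add: krein_topology_def h_def J_def Let_def)

  obtain g where g: "g \<in> G" "is_form_adjoint form g g" "g = inv g" "positive_operator form g"
    using assms(3) by (auto simp: fundamental_representation_def)
  then have "Vector_Spaces.linear cscale cscale g" "bij g"
    using assms(2) by (auto simp: unitary_operator_group_def unitary_operator_def)
  then have g_add: "g (x + y) = g x + g y" and g_scale: "g (cscale c x) = cscale c (g x)"
    for x y c
    by (meson module_hom.add module_hom.scale module_hom_iff_linear)+
  have gg: "g (g x) = x" for x
    using \<open>bij g\<close> g(3) by (metis bij_inv_eq_iff)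
  have g_adj: "form (g x) y = form x (g y)" for x y
    using g(2) by (simp add: is_form_adjoint_def)
  define f where "f = (\<lambda>x y. form (g x) y)"
  have "form (g y) x = cnj (form (g x) y)" for x y
    by (metis form_cnj g_adj)
  then have f_herm: "hermitian_form_on cscale UNIV f"
    unfolding hermitian_form_on_def f_def g_add g_scale form_add form_scale by blast
  interpret f: semi_inner_product cscale f
  proof
    show "0 \<le> Re (f x x)" for x
      using g(4) by (simp add: positive_operator_def f_def complex_nonneg_Reals_iff)
  qed (fact f_herm)

  \<comment> \<open>Equivalence of the norms of \<open>g\<close> and \<open>J\<close>\<close>
  have f_bounded: "\<exists>C. \<forall>x. cmod (f x y) \<le> C * form_norm h x" for y
  proof -
    \<comment> \<open>The functional \<open>f _ y\<close> is represented in the Hilbert space of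
      \<open>h\<close> by the vector \<open>J (g y)\<close>.\<close>
    have "f x y = h x (J (g y))" for x
      by (simp add: f_def h J_adj JJ g_adj)
    then have "cmod (f x y) \<le> form_norm h (J (g y)) * form_norm h x" for x
      using h.Cauchy_Schwarz by (metis mult.commute)
    then show ?thesis by blast
  qed
  obtain C where C: "\<And>x. form_norm f x \<le> C * form_norm h x"
    using form_norm_dominated[OF h_ip h_complete f.semi_inner_product_axioms f_bounded] by blast

  \<comment> \<open>The same \<open>C\<close> serves because \<open>J\<close> preserves the norm of
    \<open>h\<close> and \<open>g\<close> that of \<open>f\<close>. A factor
    \<open>form_norm h x\<close> gets cancelled, hence the case distinction.\<close>
  have hf: "form_norm h x \<le> C * form_norm f x" for x
  proof (cases "form_norm h x = 0")
    case True
    then have "x = 0" by (simp add: h.form_norm_eq_0_iff)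
    then show ?thesis
      by (simp add: f.form_norm_zero h.form_norm_zero)
  next
    case False
    then have h0: "0 < form_norm h x"
      using h.form_norm_nonneg by (metis less_eq_real_def)
    have hJ: "form_norm h (J x) = form_norm h x"
      by (simp add: form_norm_def h JJ J_adj)
    have fg: "form_norm f (g y) = form_norm f y" for y
      by (simp add: form_norm_def f_def gg g_adj)
    have "(form_norm h x)\<^sup>2 = Re (f (g (J x)) x)"
      by (simp add: h.form_norm_square f_def gg h)
    also have "\<dots> \<le> form_norm f (g (J x)) * form_norm f x"
      using f.Cauchy_Schwarz complex_Re_le_cmod order_trans by blast
    also have "\<dots> \<le> (C * form_norm h x) * form_norm f x"
      using C[of "J x"] by (simp add: fg hJ mult_right_mono f.form_norm_nonneg)
    finally show ?thesis
      using h0 by (simp add: power2_eq_square)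
  qed

  \<comment> \<open>Definiteness passes from \<open>h\<close> to \<open>f\<close> through
    \<open>hf\<close>.\<close>
  have f_ip: "inner_product cscale f"
  proof
    fix x :: 'a assume "x \<noteq> 0"
    then have "form_norm f x \<noteq> 0"
      using hf[of x] h.form_norm_nonneg[of x] h.form_norm_eq_0_iff[of x] by auto
    then show "0 < Re (f x x)"
      using f.nonneg[of x] by (auto simp: form_norm_def)
  qed
  interpret f: inner_product cscale f by fact

  \<comment> \<open>Regularity of closed invariant subspaces\<close>
  have "S = {0} \<or> S = UNIV" if S: "closed_subspace cscale form S" "invariant_under G S" for S
  proof -
    have "Metric_space.mcomplete S (form_dist S f)"
      using mcomplete_form_dist_closedin[OF h_ip h_complete f_ip C hf] S(1)
      by (simp add: closed_subspace_def topology)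
    moreover have "hermitian_form_on cscale S f"
      using f_herm unfolding hermitian_form_on_def by blast
    moreover have "\<forall>x\<in>S. g x \<in> S"
      using S(2) g(1) by (auto simp: invariant_under_def)
    \<comment> \<open>Here membership of \<open>g\<close> in \<open>G\<close> matters:
      \<open>g\<close> maps \<open>S\<close> into itself, whereas \<open>J\<close> need not.\<close>
    ultimately have "fundamental_symmetry_on cscale S form g"
      using f.pos
      unfolding fundamental_symmetry_on_def hilbert_inner_product_on_def inner_product_on_def
      by (simp add: g_add g_scale gg f_def)
    moreover have "hermitian_form_on cscale S form"
      using herm unfolding hermitian_form_on_def by blast
    ultimately have "regular_subspace cscale form S"
      using S(1) vector_space_axioms
      by (auto simp: regular_subspace_def krein_space_on_def closed_subspace_def)
    then show ?thesis
      using assms(4) S(2) by (auto simp: regularly_irreducible_def)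
  qed
  then show ?thesis
    by (auto simp: topologically_irreducible_def)
qed

end
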